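(* Let $f:\mathbb{R}^n\to\mathbb{R}$ be convex and differentiable with $L$-Lipschitz continuous gradient ($L>0$), let $s\in\mathbb{N}$, assume that $f$ is bounded below on $A_s=\{w\in\mathbb{R}^n:\|w\|_0\le s\}$, and let $\lambda\in(0,L^{-1})$. Let $\{w^k\}$ be a sequence generated by the projected gradient iteration $w^{k+1}\in T^\lambda_{\mathrm{PG}}(w^k):=P_{A_s}(w^k-\lambda\nabla f(w^k))$. Then: (a) (Subsequential convergence) Either $\{f(w^k)\}$ is strictly decreasing, or there exists $N>0$ such that $w^k=w^N$ for all $k\ge N$. In addition, any accumulation point $w^*$ of $\{w^k\}$ satisfies $w^*\in P_{A_s}(w^*-\lambda\nabla f(w^* ))$, and is hence a stationary point of the problem $\min_{w\in A_s}f(w)$. (b) (Subspace identification and full convergence) There exists $N\in\mathbb{N}$ such that $$\{w^k\}_{k=N}^\infty\subseteq\bigcup_{J\in\mathcal{I}_{w^*}}A_J,\qquad \mathcal{I}_{w^*}:=\{J\in\mathcal{J}_s:\ w^*\in A_J\},\qquad(\ast)$$ whenever $w^k\to w^*$. In particular, if $T^\lambda_{\mathrm{PG}}(w^* )$ is a singleton for an accumulation point $w^*$ of $\{w^k\}$, then $w^*$ is a local minimum for $\min_{w\in A_s}f(w)$, $w^k\to w^*$, and $(\ast)$ holds. (c) ($Q$-linear convergence) If $T^\lambda_{\mathrm{PG}}(w^* )$ is a singleton for an accumulation point $w^*$ of $\{w^k\}$ and the map $w\mapsto w-\lambda\nabla f(w)$ is a contraction over $A_J$ for all $J\in\mathcal{I}_{w^*}$,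 then $\{w^k\}$ converges to $w^*$ at a $Q$-linear rate. In other words, there are $N_2\in\mathbb{N}$ and $\gamma\in[0,1)$ such that $$\|w^{k+1}-w^*\|\le\gamma\|w^k-w^*\|\qquad\forall k\ge N_2.$$
   Context: $\|w\|_0$ is the number of nonzero components of $w\in\mathbb{R}^n$; $\|\cdot\|$ is the Euclidean norm. $P_{A_s}(z)$ is the (possibly set-valued) projection, i.e. the set of all points of $A_s$ at minimal Euclidean distance from $z$. $\mathcal{J}_s:=\{J\subseteq\{1,\dots,n\}:|J|=s\}$ and $A_J:=\mathrm{span}\{e_j:j\in J\}$, with $e_j$ the $j$th standard unit vector, so that $A_s=\bigcup_{J\in\mathcal{J}_s}A_J$. A map $F$ is a contraction over $A_J$ if there is $\gamma_J\in[0,1)$ with $\|F(w)-F(w')\|\le\gamma_J\|w-w'\|$ for all $w,w'\in A_J$. A point $w^*\in A_s$ is a stationary point of $\min_{w\in A_s}f(w)$ if $0\in\nabla f(w^* )+\partial\delta_{A_s}(w^* )$, where $\delta_{A_s}$ is the indicator function of $A_s$ ($0$ on $A_s$, $+\infty$ elsewhere) and $\partial$ denotes the limiting subdifferential. A local minimum for $\min_{w\in A_s}f(w)$ is a point $w^*\in A_s$ with $f(w^* )\le f(w)$ for all $w\in A_s$ in some neighborhood of $w^*$.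
   Formalization: The dichotomy in (a) is stated only for w^0 in A_s and for sequences that stay put once w^{k+1}=w^k; without either it fails (infeasible start, or a repeated point where the projection is set-valued). Also s ≤ n, as A_s = union of the A_J requires. *)

theory Defs
  imports "HOL-Analysis.Analysis"
begin

section \<open>Sparse vectors\<close>

definition norm0 :: "real ^ 'n \<Rightarrow> nat" where
  "norm0 w = card {i. w $ i \<noteq> 0}"

definition sparse_set :: "nat \<Rightarrow> (real ^ 'n) set" where
  "sparse_set s = {w. norm0 w \<le> s}"

definition index_sets :: "nat \<Rightarrow> 'n::finite set set" where
  "index_sets s = {J. card J = s}"

definition coord_subspace :: "'n set \<Rightarrow> (real ^ 'n) set" where
  "coord_subspace J = span ((\<lambda>j. axis j 1) ` J)"

definition active_index_sets :: "nat \<Rightarrow> real ^ 'n \<Rightarrow> 'n set set" where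
  "active_index_sets s w = {J \<in> index_sets s. w \<in> coord_subspace J}"

lemma mem_coord_subspace_iff:
  fixes w :: "real ^ 'n"
  shows "w \<in> coord_subspace J \<longleftrightarrow> (\<forall>i. i \<notin> J \<longrightarrow> w $ i = 0)"
proof
  assume "w \<in> coord_subspace J"
  then have "w \<in> span ((\<lambda>j. axis j 1) ` J)"
    by (simp add: coord_subspace_def)
  moreover have "subspace {w :: real ^ 'n. \<forall>i. i \<notin> J \<longrightarrow> w $ i = 0}"
    by (auto simp: subspace_def)
  moreover have "(\<lambda>j. axis j 1) ` J \<subseteq> {w :: real ^ 'n. \<forall>i. i \<notin> J \<longrightarrow> w $ i = 0}"
    by (auto simp: axis_def)
  ultimately show "\<forall>i. i \<notin> J \<longrightarrow> w $ i = 0"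
    using span_minimal by blast
next
  assume w: "\<forall>i. i \<notin> J \<longrightarrow> w $ i = 0"
  have "w = (\<Sum>i\<in>UNIV. w $ i *\<^sub>R axis i 1)"
    by (simp add: vec_eq_iff axis_def if_distrib sum.delta' cong: if_cong)
  also have "\<dots> = (\<Sum>i\<in>J. w $ i *\<^sub>R axis i 1)"
    by (rule sum.mono_neutral_right) (use w in auto)
  also have "\<dots> \<in> coord_subspace J"
    unfolding coord_subspace_def by (intro span_sum span_scale span_base) auto
  finally show "w \<in> coord_subspace J" .
qed

text \<open>For \<open>s\<close> larger than the dimension \<open>index_sets s\<close> is empty and the following
  identity fails.\<close>

lemma sparse_set_eq_Union:
  assumes "s \<le> CARD('n)"
  shows "(sparse_set s :: (real ^ 'n) set) = (\<Union>J\<in>index_sets s. coord_subspace J)"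
proof (intro equalityI subsetI)
  fix w :: "real ^ 'n" assume "w \<in> sparse_set s"
  then have "card {i. w $ i \<noteq> 0} \<le> s"
    by (simp add: sparse_set_def norm0_def)
  then obtain J where "{i. w $ i \<noteq> 0} \<subseteq> J" "card J = s"
    using exists_subset_between[of "{i. w $ i \<noteq> 0}" s UNIV] assms by auto
  then show "w \<in> (\<Union>J\<in>index_sets s. coord_subspace J)"
    by (auto simp: index_sets_def mem_coord_subspace_iff)
next
  fix w :: "real ^ 'n" assume "w \<in> (\<Union>J\<in>index_sets s. coord_subspace J)"
  then obtain J where J: "card J = s" "\<forall>i. i \<notin> J \<longrightarrow> w $ i = 0"
    by (auto simp: index_sets_def mem_coord_subspace_iff)
  then have "card {i. w $ i \<noteq> 0} \<le> card J"
    by (intro card_mono) auto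
  with J show "w \<in> sparse_set s"
    by (simp add: sparse_set_def norm0_def)
qed


section \<open>Set-valued projection and the projected gradient map\<close>

definition proj_set :: "'a::metric_space set \<Rightarrow> 'a \<Rightarrow> 'a set" where
  "proj_set A z = {x \<in> A. \<forall>y\<in>A. dist z x \<le> dist z y}"

definition gradient :: "('a::euclidean_space \<Rightarrow> real) \<Rightarrow> 'a \<Rightarrow> 'a" where
  "gradient f x = (THE d. GDERIV f x :> d)"

lemma gradient_eqI:
  assumes "GDERIV f x :> d"
  shows "gradient f x = d"
  unfolding gradient_def
proof (rule the_equality[where P = "\<lambda>d. GDERIV f x :> d", OF assms])
  fix e assume "GDERIV f x :> e"
  with assms have "(\<lambda>h. inner h d) = (\<lambda>h. inner h e)"
    unfolding gderiv_def by (rule has_derivative_unique)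
  then show "e = d"
    by (metis vector_eq_ldot)
qed

lemma GDERIV_gradient:
  assumes "f differentiable (at x)"
  shows "GDERIV f x :> gradient f x"
proof -
  obtain D where D: "(f has_derivative D) (at x)"
    using assms by (auto simp: differentiable_def)
  then have "linear D"
    by (rule has_derivative_linear)
  then have "D = (\<lambda>h. inner h (adjoint D 1))"
    using adjoint_works[of D _ 1] by auto
  with D have "GDERIV f x :> adjoint D 1"
    unfolding gderiv_def by simp
  then show ?thesis
    using gradient_eqI by metis
qed

definition pg_step :: "(real ^ 'n \<Rightarrow> real) \<Rightarrow> nat \<Rightarrow> real \<Rightarrow> real ^ 'n \<Rightarrow> (real ^ 'n) set" where
  "pg_step f s lam w = proj_set (sparse_set s) (w - lam *\<^sub>R gradient f w)"


section \<open>Limiting subdifferential, stationarity and local minimality\<close>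

definition indicator_ereal :: "'a set \<Rightarrow> 'a \<Rightarrow> ereal" where
  "indicator_ereal A x = (if x \<in> A then 0 else \<infinity>)"

definition regular_subdiff :: "('a::euclidean_space \<Rightarrow> ereal) \<Rightarrow> 'a \<Rightarrow> 'a set" where
  "regular_subdiff \<phi> x = {v. \<bar>\<phi> x\<bar> \<noteq> \<infinity> \<and>
     Liminf (at x) (\<lambda>y. (\<phi> y - \<phi> x - ereal (v \<bullet> (y - x))) / ereal (norm (y - x))) \<ge> 0}"

definition limiting_subdiff :: "('a::euclidean_space \<Rightarrow> ereal) \<Rightarrow> 'a \<Rightarrow> 'a set" where
  "limiting_subdiff \<phi> x = {v. \<bar>\<phi> x\<bar> \<noteq> \<infinity> \<and>
     (\<exists>y u. y \<longlonglongrightarrow> x \<and> (\<lambda>k. \<phi> (y k)) \<longlonglongrightarrow> \<phi> x \<and>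
            (\<forall>k. u k \<in> regular_subdiff \<phi> (y k)) \<and> u \<longlonglongrightarrow> v)}"

definition stationary_point :: "('a::euclidean_space \<Rightarrow> real) \<Rightarrow> 'a set \<Rightarrow> 'a \<Rightarrow> bool" where
  "stationary_point f A x \<longleftrightarrow> x \<in> A \<and>
     0 \<in> (\<lambda>v. gradient f x + v) ` limiting_subdiff (indicator_ereal A) x"

definition local_minimum :: "('a::topological_space \<Rightarrow> real) \<Rightarrow> 'a set \<Rightarrow> 'a \<Rightarrow> bool" where
  "local_minimum f A x \<longleftrightarrow> x \<in> A \<and> (\<exists>U. open U \<and> x \<in> U \<and> (\<forall>y \<in> A \<inter> U. f x \<le> f y))"


section \<open>Accumulation points and contractions\<close>

definition accumulation_point :: "(nat \<Rightarrow> 'a::topological_space) \<Rightarrow> 'a \<Rightarrow> bool" where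
  "accumulation_point w x \<longleftrightarrow> (\<exists>r. strict_mono r \<and> (w \<circ> r) \<longlonglongrightarrow> x)"

text \<open>\<open>C-lipschitz_on\<close> includes \<open>0 \<le> C\<close>.\<close>

definition contraction_over :: "'a::metric_space set \<Rightarrow> ('a \<Rightarrow> 'a) \<Rightarrow> bool" where
  "contraction_over A F \<longleftrightarrow> (\<exists>\<gamma><1. \<gamma>-lipschitz_on A F)"

end

theory Submission
  imports Defs
begin

text \<open>
  Write \<open>F u = u - lam *\<^sub>R gradient f u\<close>, so that an iteration projects \<open>F (w k)\<close> onto the
  union \<open>A\<close> of finitely many coordinate subspaces. Two properties of a convex function with
  \<open>L\<close>-Lipschitz gradient drive the proof.

  The first is the quadratic upper bound \<open>lipschitz_gradient_descent\<close>. The projected point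
  minimises over \<open>A\<close> a quadratic model of \<open>f\<close> whose curvature \<open>1 / lam\<close> exceeds \<open>L\<close>. The objective
  hence drops by a multiple of the squared step length, and since \<open>f\<close> is bounded below on \<open>A\<close>, the
  steps tend to zero. Every accumulation point is then a fixed point of the projected gradient
  map, because the graph of the projection onto a closed set is closed. At a fixed point the
  defining inequality of the projection says that the negative gradient is a regular normal to
  \<open>A\<close> up to a second-order term, which is stationarity. On each subspace through the fixed point
  the second-order term can be scaled away, and convexity gives local minimality.

  The second is cocoercivity of the gradient (\<open>gradient_cocoercive\<close>), which makes \<open>F\<close>
  nonexpansive. Sparse vectors close to \<open>x\<close> are nonzero wherever \<open>x\<close> is, so they lie in a subspace
  that also contains \<open>x\<close>. If the projection of \<open>F x\<close> is the single point \<open>x\<close>, it depends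
  continuously on its argument there, and near \<open>x\<close> a step lands in one of those subspaces \<open>S\<close>.
  The new iterate and \<open>x\<close> are then both projections onto the same convex set \<open>S\<close>, of \<open>F (w k)\<close> and
  \<open>F x\<close>, so the new distance to \<open>x\<close> is at most the distance from \<open>F (w k)\<close> to \<open>F x\<close>
  (\<open>pg_step_near_singleton_fixed_point\<close>). The subspace may change from one step to the next, but
  the bound does not depend on it. Nonexpansiveness of \<open>F\<close> now shows that an iterate close to \<open>x\<close>
  never moves away from \<open>x\<close> again, which upgrades accumulation to convergence; if \<open>F\<close> is a
  contraction on the finitely many subspaces through \<open>x\<close>, the same bound gives the linear rate,
  because every late iterate shares one of these subspaces with \<open>x\<close>.
\<close>

section \<open>Smooth convex functions\<close>

lemma GDERIV_along_line:
  fixes f :: "'a::euclidean_space \<Rightarrow> real"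
  assumes "GDERIV f (x + t *\<^sub>R h) :> d"
  shows "((\<lambda>t. f (x + t *\<^sub>R h)) has_real_derivative h \<bullet> d) (at t)"
proof -
  have "((\<lambda>t. x + t *\<^sub>R h) has_derivative (\<lambda>t. t *\<^sub>R h)) (at t)"
    by (auto intro!: derivative_eq_intros)
  then have "((\<lambda>t. f (x + t *\<^sub>R h)) has_derivative (\<lambda>t. (t *\<^sub>R h) \<bullet> d)) (at t)"
    using assms unfolding gderiv_def by (rule has_derivative_compose)
  then show ?thesis
    by (simp add: has_field_derivative_def mult_commute_abs)
qed

lemma convex_on_above_tangent:
  fixes f :: "'a::euclidean_space \<Rightarrow> real"
  assumes "convex_on UNIV f" and "GDERIV f x :> d"
  shows "f x + d \<bullet> (y - x) \<le> f y"
proof -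
  have "convex_on UNIV (\<lambda>t. f (x + t *\<^sub>R (y - x)))"
  proof (rule convex_onI)
    fix t a b :: real assume t: "0 < t" "t < 1"
    have "x + ((1 - t) *\<^sub>R a + t *\<^sub>R b) *\<^sub>R (y - x)
        = (1 - t) *\<^sub>R (x + a *\<^sub>R (y - x)) + t *\<^sub>R (x + b *\<^sub>R (y - x))"
      by (simp add: algebra_simps)
    then show "f (x + ((1 - t) *\<^sub>R a + t *\<^sub>R b) *\<^sub>R (y - x))
        \<le> (1 - t) * f (x + a *\<^sub>R (y - x)) + t * f (x + b *\<^sub>R (y - x))"
      using t by (auto intro: convex_onD[OF assms(1)])
  qed simp
  moreover have "((\<lambda>t. f (x + t *\<^sub>R (y - x))) has_real_derivative (y - x) \<bullet> d) (at 0)"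
    by (rule GDERIV_along_line) (simp add: assms)
  ultimately show ?thesis
    using convex_on_imp_above_tangent[of UNIV "\<lambda>t. f (x + t *\<^sub>R (y - x))" 0 1 "(y - x) \<bullet> d"]
    by (simp add: inner_commute)
qed

text \<open>On the segment from \<open>x\<close> to \<open>y\<close> the difference between the two sides is monotone,
  because the Lipschitz bound controls the directional derivative.\<close>

lemma lipschitz_gradient_descent:
  fixes f :: "'a::euclidean_space \<Rightarrow> real"
  assumes grad: "\<And>x. GDERIV f x :> g x" and lip: "L-lipschitz_on UNIV g"
  shows "f y \<le> f x + g x \<bullet> (y - x) + L / 2 * (norm (y - x))\<^sup>2"
proof -
  define h where "h = y - x"
  define p where "p t = f (x + t *\<^sub>R h) - t * (g x \<bullet> h) - L / 2 * t\<^sup>2 * (norm h)\<^sup>2" for t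
  have "p 1 \<le> p 0"
  proof (rule DERIV_nonpos_imp_nonincreasing[of 0 1 p])
    fix t :: real assume t: "0 \<le> t" "t \<le> 1"
    have "(p has_real_derivative h \<bullet> g (x + t *\<^sub>R h) - g x \<bullet> h - L * t * (norm h)\<^sup>2) (at t)"
      unfolding p_def by (auto intro!: derivative_eq_intros GDERIV_along_line[OF grad])
    moreover have "h \<bullet> g (x + t *\<^sub>R h) - g x \<bullet> h \<le> L * t * (norm h)\<^sup>2"
    proof -
      have "h \<bullet> g (x + t *\<^sub>R h) - g x \<bullet> h = h \<bullet> (g (x + t *\<^sub>R h) - g x)"
        by (simp add: inner_diff_right inner_commute)
      also have "\<dots> \<le> norm h * norm (g (x + t *\<^sub>R h) - g x)"
        by (rule norm_cauchy_schwarz)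
      also have "\<dots> \<le> norm h * (L * norm (t *\<^sub>R h))"
        using lipschitz_onD[OF lip, of "x + t *\<^sub>R h" x]
        by (intro mult_left_mono) (auto simp: dist_norm)
      finally show ?thesis
        using t by (simp add: power2_eq_square mult_ac)
    qed
    ultimately show "\<exists>d. (p has_real_derivative d) (at t) \<and> d \<le> 0"
      by (intro exI conjI) auto
  qed simp
  then show ?thesis
    by (simp add: p_def h_def)
qed

text \<open>The point \<open>z\<close> is a gradient step from \<open>y\<close> for the tilted function \<open>\<lambda>u. f u - g x \<bullet> u\<close>, which is
  minimal at \<open>x\<close>. The descent bound at \<open>z\<close> then shows that the tilted value at \<open>y\<close> exceeds the
  minimum by at least the stated square.\<close>

lemma gradient_strengthened_tangent:
  fixes f :: "'a::euclidean_space \<Rightarrow> real"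
  assumes conv: "convex_on UNIV f" and grad: "\<And>x. GDERIV f x :> g x"
    and lip: "L-lipschitz_on UNIV g" and L: "L > 0"
  shows "f x + g x \<bullet> (y - x) + (norm (g y - g x))\<^sup>2 / (2 * L) \<le> f y"
proof -
  define e where "e = g y - g x"
  define z where "z = y - (1 / L) *\<^sub>R e"
  have "f x + g x \<bullet> (z - x) \<le> f z"
    by (rule convex_on_above_tangent[OF conv grad])
  also have "\<dots> \<le> f y + g y \<bullet> (z - y) + L / 2 * (norm (z - y))\<^sup>2"
    by (rule lipschitz_gradient_descent[OF grad lip])
  finally have "f x + g x \<bullet> (y - x) + e \<bullet> (y - z) - L / 2 * (norm (z - y))\<^sup>2 \<le> f y"
    by (simp add: e_def inner_diff_left inner_diff_right algebra_simps)
  moreover have "e \<bullet> (y - z) - L / 2 * (norm (z - y))\<^sup>2 = (norm e)\<^sup>2 / (2 * L)"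
    using L by (simp add: z_def power_divide dot_square_norm field_simps power2_eq_square[of L])
  ultimately show ?thesis
    by (simp add: e_def)
qed

text \<open>The theorem of Baillon and Haddad: add the strengthened tangent inequality for \<open>(x, y)\<close> to the
  one for \<open>(y, x)\<close>.\<close>

lemma gradient_cocoercive:
  fixes f :: "'a::euclidean_space \<Rightarrow> real"
  assumes "convex_on UNIV f" and "\<And>x. GDERIV f x :> g x"
    and "L-lipschitz_on UNIV g" and L: "L > 0"
  shows "(norm (g x - g y))\<^sup>2 \<le> L * ((g x - g y) \<bullet> (x - y))"
proof -
  have "(norm (g x - g y))\<^sup>2 / L \<le> (g x - g y) \<bullet> (x - y)"
    using gradient_strengthened_tangent[OF assms, of x y]
      gradient_strengthened_tangent[OF assms, of y x]
    by (simp add: inner_diff_left inner_diff_right norm_minus_commute[of "g y"] field_simps)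
  then show ?thesis
    using L by (simp add: pos_divide_le_eq mult.commute)
qed

lemma gradient_step_nonexpansive:
  fixes f :: "'a::euclidean_space \<Rightarrow> real"
  assumes "convex_on UNIV f" and "\<And>x. GDERIV f x :> g x"
    and "L-lipschitz_on UNIV g" and "L > 0"
    and lam: "0 \<le> lam" "lam * L \<le> 2"
  shows "norm ((x - lam *\<^sub>R g x) - (y - lam *\<^sub>R g y)) \<le> norm (x - y)"
proof -
  define d where "d = g x - g y"
  define m where "m = d \<bullet> (x - y)"
  have co: "(norm d)\<^sup>2 \<le> L * m"
    using gradient_cocoercive[OF assms(1-4)] by (simp add: d_def m_def)
  then have "0 \<le> L * m"
    by (rule order_trans[rotated]) simp
  then have "0 \<le> m"
    using \<open>L > 0\<close> by (simp add: zero_le_mult_iff)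
  have "(norm ((x - lam *\<^sub>R g x) - (y - lam *\<^sub>R g y)))\<^sup>2
      = (norm (x - y))\<^sup>2 - 2 * lam * m + lam\<^sup>2 * (norm d)\<^sup>2"
    unfolding d_def m_def power2_norm_eq_inner power2_eq_square[of lam]
    by (simp add: inner_diff_left inner_diff_right algebra_simps inner_commute)
  also have "\<dots> \<le> (norm (x - y))\<^sup>2 - 2 * lam * m + lam\<^sup>2 * (L * m)"
    using co by (intro add_left_mono mult_left_mono) auto
  also have "\<dots> = (norm (x - y))\<^sup>2 - (lam * m) * (2 - lam * L)"
    by (simp add: power2_eq_square algebra_simps)
  also have "\<dots> \<le> (norm (x - y))\<^sup>2"
    using lam \<open>0 \<le> m\<close> by simp
  finally show ?thesis
    by (rule power2_le_imp_le) simp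
qed


section \<open>Set-valued projections\<close>

lemma proj_set_mono:
  assumes "p \<in> proj_set A z" "p \<in> B" "B \<subseteq> A"
  shows "p \<in> proj_set B z"
  using assms by (auto simp: proj_set_def)

lemma proj_set_convex_nonexpansive:
  fixes S :: "'a::euclidean_space set"
  assumes S: "convex S" "closed S" and p: "p \<in> proj_set S y" and q: "q \<in> proj_set S z"
  shows "norm (p - q) \<le> norm (y - z)"
proof -
  have "p = closest_point S y" "q = closest_point S z"
    using p q by (auto intro!: closest_point_unique[OF S] simp: proj_set_def)
  moreover have "S \<noteq> {}"
    using p by (auto simp: proj_set_def)
  ultimately show ?thesis
    using closest_point_lipschitz[OF S] by (simp add: dist_norm)
qed

lemma proj_set_closed_graph:
  assumes "closed A" "\<And>n. p n \<in> proj_set A (z n)" "z \<longlonglongrightarrow> z0" "p \<longlonglongrightarrow> p0"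
  shows "p0 \<in> proj_set A z0"
proof -
  have "p0 \<in> A"
    using assms(2) by (intro closed_sequentially[OF assms(1) _ assms(4)]) (auto simp: proj_set_def)
  moreover have "dist z0 p0 \<le> dist z0 y" if "y \<in> A" for y
    by (rule LIMSEQ_le[of "\<lambda>n. dist (z n) (p n)" _ "\<lambda>n. dist (z n) y"])
       (use assms that in \<open>auto intro!: tendsto_intros simp: proj_set_def\<close>)
  ultimately show ?thesis
    by (auto simp: proj_set_def)
qed

text \<open>The \<open>p n\<close> are bounded, and by the closed graph each of their limit points is a projection of
  \<open>z0\<close>, of which there is only one.\<close>

lemma proj_set_singleton_continuous:
  fixes A :: "'a::heine_borel set"
  assumes "closed A" and single: "proj_set A z0 = {p0}"
    and z: "z \<longlonglongrightarrow> z0" and p: "\<And>n. p n \<in> proj_set A (z n)"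
  shows "p \<longlonglongrightarrow> p0"
proof (rule ccontr)
  assume "\<not> p \<longlonglongrightarrow> p0"
  then obtain e where "e > 0" and "frequently (\<lambda>n. \<not> dist (p n) p0 < e) sequentially"
    by (auto simp: tendsto_iff frequently_def)
  then have "infinite {n. \<not> dist (p n) p0 < e}"
    by (simp add: frequently_cofinite flip: cofinite_eq_sequentially)
  then obtain r :: "nat \<Rightarrow> nat" where r: "strict_mono r" "\<And>n. \<not> dist (p (r n)) p0 < e"
    using infinite_enumerate by blast
  have zr: "(\<lambda>n. z (r n)) \<longlonglongrightarrow> z0"
    using LIMSEQ_subseq_LIMSEQ[OF z r(1)] by (simp add: o_def)
  have p0: "p0 \<in> A"
    using single by (auto simp: proj_set_def)
  have "bounded (range (\<lambda>n. z (r n)))"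
    using zr by (rule convergent_imp_bounded)
  then obtain B where B: "\<And>n. dist p0 (z (r n)) \<le> B"
    unfolding bounded_any_center[of _ p0] by blast
  have "dist p0 (p (r n)) \<le> 2 * B" for n
  proof -
    have "dist (z (r n)) (p (r n)) \<le> dist (z (r n)) p0"
      using p[of "r n"] p0 by (auto simp: proj_set_def)
    then show ?thesis
      using B[of n] dist_triangle[of p0 "p (r n)" "z (r n)"] by (simp add: dist_commute)
  qed
  then have "bounded (range (\<lambda>n. p (r n)))"
    unfolding bounded_def by blast
  then obtain l q where q: "strict_mono q" "((\<lambda>n. p (r n)) \<circ> q) \<longlonglongrightarrow> l"
    using bounded_imp_convergent_subsequence by blast
  have "l \<in> proj_set A z0"
    by (rule proj_set_closed_graph[OF assms(1), of "\<lambda>n. p (r (q n))" "\<lambda>n. z (r (q n))"])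
       (use q LIMSEQ_subseq_LIMSEQ[OF zr q(1)] p in \<open>auto simp: o_def\<close>)
  with single have "l = p0"
    by simp
  with q(2) \<open>e > 0\<close> have "eventually (\<lambda>n. dist (p (r (q n))) p0 < e) sequentially"
    by (auto simp: tendsto_iff o_def)
  with r(2) show False
    by simp
qed

text \<open>The minimality of \<open>p\<close>, with the squared distances to \<open>u - lam *\<^sub>R v\<close> expanded around \<open>u\<close> and the
  common term \<open>(lam * norm v)\<^sup>2\<close> cancelled.\<close>

lemma proj_set_variational:
  fixes A :: "'a::real_inner set"
  assumes "p \<in> proj_set A (u - lam *\<^sub>R v)" "y \<in> A"
  shows "2 * lam * (v \<bullet> (p - u)) + (norm (p - u))\<^sup>2 \<le> 2 * lam * (v \<bullet> (y - u)) + (norm (y - u))\<^sup>2"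
proof -
  have "norm (u - lam *\<^sub>R v - p) \<le> norm (u - lam *\<^sub>R v - y)"
    using assms by (auto simp: proj_set_def dist_norm)
  then have "(norm (u - lam *\<^sub>R v - p))\<^sup>2 \<le> (norm (u - lam *\<^sub>R v - y))\<^sup>2"
    by (rule power_mono) simp
  then show ?thesis
    by (simp add: power2_norm_eq_inner inner_diff_left inner_diff_right algebra_simps inner_commute)
qed

lemma proj_set_fixed_point_variational:
  fixes A :: "'a::real_inner set"
  assumes "x \<in> proj_set A (x - lam *\<^sub>R v)" "y \<in> A"
  shows "0 \<le> 2 * lam * (v \<bullet> (y - x)) + (norm (y - x))\<^sup>2"
  using proj_set_variational[OF assms] by simp


section \<open>Stationarity of fixed points\<close>

lemma regular_subdiff_subset_limiting_subdiff:
  "regular_subdiff \<phi> x \<subseteq> limiting_subdiff \<phi> x"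
proof
  fix v assume "v \<in> regular_subdiff \<phi> x"
  then show "v \<in> limiting_subdiff \<phi> x"
    unfolding limiting_subdiff_def
    by (intro CollectI conjI exI[of _ "\<lambda>_::nat. x"] exI[of _ "\<lambda>_::nat. v"])
       (auto simp: regular_subdiff_def)
qed

text \<open>For \<open>y \<in> A\<close> the fixed-point inequality bounds \<open>- v \<bullet> (y - x)\<close> by
  \<open>(norm (y - x))\<^sup>2 / (2 * lam)\<close>, which is \<open>o(norm (y - x))\<close>.\<close>

lemma proj_set_fixed_point_regular_normal:
  fixes A :: "'a::euclidean_space set"
  assumes fp: "x \<in> proj_set A (x - lam *\<^sub>R v)" and lam: "lam > 0"
  shows "- v \<in> regular_subdiff (indicator_ereal A) x"
proof -
  have x: "x \<in> A"
    using fp by (auto simp: proj_set_def)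
  define q where "q y = (indicator_ereal A y - indicator_ereal A x - ereal (- v \<bullet> (y - x)))
      / ereal (norm (y - x))" for y
  have bound: "ereal (- (norm (y - x) / (2 * lam))) \<le> q y" if "y \<noteq> x" for y
  proof (cases "y \<in> A")
    case True
    have "0 \<le> 2 * lam * (v \<bullet> (y - x)) + (norm (y - x))\<^sup>2"
      by (rule proj_set_fixed_point_variational[OF fp True])
    then have "- (norm (y - x) / (2 * lam)) \<le> (v \<bullet> (y - x)) / norm (y - x)"
      using that lam by (simp add: field_simps power2_eq_square)
    with that True x show ?thesis
      by (simp add: q_def indicator_ereal_def)
  next
    case False
    with that x show ?thesis
      by (simp add: q_def indicator_ereal_def)
  qed
  have "((\<lambda>y. ereal (- (norm (y - x) / (2 * lam)))) \<longlongrightarrow> ereal (- (norm (x - x) / (2 * lam)))) (at x)"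
    by (intro tendsto_intros) (use lam in auto)
  then have "Liminf (at x) (\<lambda>y. ereal (- (norm (y - x) / (2 * lam)))) = 0"
    by (intro lim_imp_Liminf) (auto simp: zero_ereal_def)
  moreover have "Liminf (at x) (\<lambda>y. ereal (- (norm (y - x) / (2 * lam)))) \<le> Liminf (at x) q"
    by (rule Liminf_mono) (auto simp: eventually_at_filter bound)
  ultimately have "0 \<le> Liminf (at x) q"
    by simp
  then show ?thesis
    using x by (simp add: regular_subdiff_def q_def[abs_def] indicator_ereal_def)
qed

lemma proj_set_fixed_point_stationary:
  assumes "x \<in> proj_set A (x - lam *\<^sub>R gradient f x)" "lam > 0"
  shows "stationary_point f A x"
proof -
  have "- gradient f x \<in> limiting_subdiff (indicator_ereal A) x"
    using proj_set_fixed_point_regular_normal[OF assms] regular_subdiff_subset_limiting_subdiff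
    by blast
  then show ?thesis
    using assms(1) by (force simp: stationary_point_def proj_set_def image_iff)
qed


section \<open>Sparse vectors near a sparse vector\<close>

lemma subspace_coord_subspace: "subspace (coord_subspace J)"
  by (simp add: coord_subspace_def)

lemma coord_subspace_subset_sparse_set:
  fixes J :: "'n::finite set"
  assumes "J \<in> active_index_sets s (x :: real ^ 'n)"
  shows "(coord_subspace J :: (real ^ 'n) set) \<subseteq> sparse_set s"
proof -
  have "J \<in> index_sets s"
    using assms by (simp add: active_index_sets_def)
  moreover from this have "s \<le> CARD('n)"
    by (auto simp: index_sets_def intro: card_mono)
  ultimately show ?thesis
    by (auto simp: sparse_set_eq_Union)
qed

lemma closed_sparse_set:
  assumes "s \<le> CARD('n)"
  shows "closed (sparse_set s :: (real ^ 'n) set)"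
  unfolding sparse_set_eq_Union[OF assms]
  by (intro closed_UN ballI closed_subspace subspace_coord_subspace) auto

lemma eventually_sparse_imp_active:
  fixes x :: "real ^ 'n"
  assumes s: "s \<le> CARD('n)"
  shows "\<forall>\<^sub>F y in nhds x. y \<in> sparse_set s \<longrightarrow> (\<exists>J\<in>active_index_sets s x. y \<in> coord_subspace J)"
proof -
  have "\<forall>\<^sub>F y in nhds x. \<forall>i\<in>{i. x $ i \<noteq> 0}. y $ i \<noteq> 0"
  proof (rule eventually_ball_finite)
    show "\<forall>i\<in>{i. x $ i \<noteq> 0}. \<forall>\<^sub>F y in nhds x. y $ i \<noteq> 0"
    proof
      fix i assume "i \<in> {i. x $ i \<noteq> 0}"
      moreover have "((\<lambda>y. y $ i) \<longlongrightarrow> x $ i) (nhds x)"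
        by (intro tendsto_vec_nth filterlim_ident)
      ultimately show "\<forall>\<^sub>F y in nhds x. y $ i \<noteq> 0"
        by (intro tendsto_imp_eventually_ne) auto
    qed
  qed simp
  then show ?thesis
  proof (rule eventually_mono, intro impI)
    fix y :: "real ^ 'n"
    assume supp: "\<forall>i\<in>{i. x $ i \<noteq> 0}. y $ i \<noteq> 0" and "y \<in> sparse_set s"
    then obtain J where "J \<in> index_sets s" "y \<in> coord_subspace J"
      using sparse_set_eq_Union[OF s] by auto
    with supp show "\<exists>J\<in>active_index_sets s x. y \<in> coord_subspace J"
      by (intro bexI[of _ J]) (auto simp: active_index_sets_def mem_coord_subspace_iff)
  qed
qed


section \<open>Local behaviour of the projected gradient map\<close>

text \<open>Only sparse \<open>y\<close> that share a coordinate subspace with \<open>x\<close> matter near \<open>x\<close>. The line through \<open>x\<close> and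
  such a \<open>y\<close> consists of sparse vectors; the fixed-point inequality along it, divided by the step
  and in the limit of small steps, says that the directional derivative towards \<open>y\<close> is
  nonnegative.\<close>

lemma fixed_point_local_minimum:
  fixes f :: "real ^ 'n \<Rightarrow> real"
  assumes conv: "convex_on UNIV f" and grad: "GDERIV f x :> v"
    and s: "s \<le> CARD('n)" and lam: "lam > 0"
    and fp: "x \<in> proj_set (sparse_set s) (x - lam *\<^sub>R v)"
  shows "local_minimum f (sparse_set s) x"
proof -
  have le: "f x \<le> f y" if J: "J \<in> active_index_sets s x" and y: "y \<in> coord_subspace J" for y J
  proof -
    have "x \<in> coord_subspace J"
      using J by (simp add: active_index_sets_def)
    with y have seg: "x + t *\<^sub>R (y - x) \<in> sparse_set s" for t
      using coord_subspace_subset_sparse_set[OF J]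
      by (meson subspace_add subspace_diff subspace_scale subspace_coord_subspace subsetD)
    have "0 \<le> 2 * lam * (v \<bullet> (y - x)) + t * (norm (y - x))\<^sup>2" if "t > 0" for t
    proof -
      have "0 \<le> t * (2 * lam * (v \<bullet> (y - x)) + t * (norm (y - x))\<^sup>2)"
        using proj_set_fixed_point_variational[OF fp seg[of t]]
        by (simp add: power_mult_distrib power2_eq_square[of t] distrib_left mult_ac)
      with that show ?thesis
        by (simp add: zero_le_mult_iff)
    qed
    then have ev: "\<forall>\<^sub>F t in at_right 0. 0 \<le> 2 * lam * (v \<bullet> (y - x)) + t * (norm (y - x))\<^sup>2"
      by (intro eventually_at_rightI[of 0 1]) auto
    have "((\<lambda>t. 2 * lam * (v \<bullet> (y - x)) + t * (norm (y - x))\<^sup>2)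
        \<longlongrightarrow> 2 * lam * (v \<bullet> (y - x)) + 0 * (norm (y - x))\<^sup>2) (at_right 0)"
      by (intro tendsto_intros)
    from tendsto_lowerbound[OF this ev] have "0 \<le> v \<bullet> (y - x)"
      using lam by (simp add: zero_le_mult_iff)
    then show ?thesis
      using convex_on_above_tangent[OF conv grad, of y] by simp
  qed
  obtain U where U: "open U" "x \<in> U"
    "\<And>y. y \<in> U \<Longrightarrow> y \<in> sparse_set s \<Longrightarrow> \<exists>J\<in>active_index_sets s x. y \<in> coord_subspace J"
    using eventually_sparse_imp_active[OF s, of x] unfolding eventually_nhds by blast
  show ?thesis
    unfolding local_minimum_def
  proof (intro conjI exI[of _ U] ballI)
    show "x \<in> sparse_set s"
      using fp by (simp add: proj_set_def)
    show "f x \<le> f y" if "y \<in> sparse_set s \<inter> U" for y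
      using U(3)[of y] le that by blast
  qed (use U in auto)
qed

text \<open>The projection onto the nonconvex set of sparse vectors behaves near a singleton fixed point
  like a projection onto a subspace through \<open>x\<close>, and those are nonexpansive. The subspace depends
  on \<open>v\<close>, but \<open>x\<close> is the projection of its own gradient step onto each of them.\<close>

lemma pg_step_near_singleton_fixed_point:
  fixes x :: "real ^ 'n"
  assumes cont: "continuous_on UNIV (gradient f)" and s: "s \<le> CARD('n)"
    and single: "pg_step f s lam x = {x}"
  obtains d where "d > 0"
    and "\<And>u v. dist u x < d \<Longrightarrow> v \<in> pg_step f s lam u \<Longrightarrow>
      norm (v - x) \<le> norm ((u - lam *\<^sub>R gradient f u) - (x - lam *\<^sub>R gradient f x))"
proof -
  define F where "F u = u - lam *\<^sub>R gradient f u" for u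
  have T: "pg_step f s lam u = proj_set (sparse_set s) (F u)" for u
    by (simp add: pg_step_def F_def)
  have nearby: "\<exists>d>0. \<forall>u v. dist u x < d \<and> v \<in> pg_step f s lam u \<longrightarrow>
      (\<exists>J\<in>active_index_sets s x. v \<in> coord_subspace J)" (is "\<exists>d>0. ?P d")
    \<comment> \<open>Otherwise some steps \<open>v n\<close> from \<open>u n \<longlonglongrightarrow> x\<close> miss these subspaces,
      although \<open>v n \<longlonglongrightarrow> x\<close>.\<close>
  proof (rule ccontr)
    assume "\<not> ?thesis"
    then have "\<forall>n::nat. \<exists>u v. dist u x < inverse (real (Suc n)) \<and> v \<in> pg_step f s lam u
        \<and> \<not> (\<exists>J\<in>active_index_sets s x. v \<in> coord_subspace J)"
      by (metis inverse_positive_iff_positive of_nat_0_less_iff zero_less_Suc)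
    then obtain u v where uv: "\<And>n::nat. dist (u n) x < inverse (real (Suc n))"
      "\<And>n. v n \<in> pg_step f s lam (u n)"
      "\<And>n. \<not> (\<exists>J\<in>active_index_sets s x. v n \<in> coord_subspace J)"
      by metis
    have "(\<lambda>n. dist (u n) x) \<longlonglongrightarrow> 0"
      by (rule tendsto_sandwich[OF _ _ tendsto_const LIMSEQ_inverse_real_of_nat])
         (use uv(1) in \<open>auto intro!: always_eventually simp: less_imp_le simp del: of_nat_Suc\<close>)
    then have u: "u \<longlonglongrightarrow> x"
      by (rule iffD2[OF tendsto_dist_iff])
    have "(\<lambda>n. gradient f (u n)) \<longlonglongrightarrow> gradient f x"
      using continuous_on_tendsto_compose[OF cont u] by simp
    with u have "(\<lambda>n. F (u n)) \<longlonglongrightarrow> F x"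
      unfolding F_def by (intro tendsto_intros)
    then have "v \<longlonglongrightarrow> x"
      by (rule proj_set_singleton_continuous[OF closed_sparse_set[OF s], rotated])
         (use single uv(2) in \<open>auto simp: T\<close>)
    then have "\<forall>\<^sub>F n in sequentially. v n \<in> sparse_set s \<longrightarrow>
        (\<exists>J\<in>active_index_sets s x. v n \<in> coord_subspace J)"
      by (rule eventually_compose_filterlim[OF eventually_sparse_imp_active[OF s]])
    with uv(2,3) show False
      by (auto simp: T proj_set_def)
  qed
  then obtain d where "d > 0" and d: "?P d"
    by blast
  show thesis
  proof
    fix u v assume u: "dist u x < d" and v: "v \<in> pg_step f s lam u"
    with d obtain J where J: "J \<in> active_index_sets s x" and vJ: "v \<in> coord_subspace J"
      by blast
    note S = subspace_coord_subspace[of J]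
    have "x \<in> proj_set (coord_subspace J) (F x)" "v \<in> proj_set (coord_subspace J) (F u)"
      using single v vJ J coord_subspace_subset_sparse_set[OF J]
      by (auto simp: T active_index_sets_def intro: proj_set_mono)
    then show "norm (v - x) \<le> norm ((u - lam *\<^sub>R gradient f u) - (x - lam *\<^sub>R gradient f x))"
      using proj_set_convex_nonexpansive[OF subspace_imp_convex[OF S] closed_subspace[OF S]]
      by (simp add: F_def)
  qed fact
qed


section \<open>Sequences generated by the projected gradient map\<close>

lemma pg_step_sufficient_decrease:
  fixes f :: "real ^ 'n \<Rightarrow> real"
  assumes grad: "\<And>x. GDERIV f x :> gradient f x" and lip: "L-lipschitz_on UNIV (gradient f)"
    and lam: "lam > 0" and u: "u \<in> sparse_set s" and v: "v \<in> pg_step f s lam u"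
  shows "(inverse lam - L) / 2 * (norm (v - u))\<^sup>2 \<le> f u - f v"
proof -
  have "2 * lam * (gradient f u \<bullet> (v - u)) + (norm (v - u))\<^sup>2 \<le> 0"
    using proj_set_variational[OF _ u, of v u lam "gradient f u"] v by (simp add: pg_step_def)
  then have "gradient f u \<bullet> (v - u) \<le> - (inverse lam / 2 * (norm (v - u))\<^sup>2)"
    using lam by (simp add: field_simps)
  moreover have "(inverse lam - L) / 2 * (norm (v - u))\<^sup>2
      = inverse lam / 2 * (norm (v - u))\<^sup>2 - L / 2 * (norm (v - u))\<^sup>2"
    by (simp only: diff_divide_distrib left_diff_distrib)
  ultimately show ?thesis
    using lipschitz_gradient_descent[OF grad lip, of v u] by linarith
qed

text \<open>The starting point need not be sparse, so the objective is only known to decrease from index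
  \<open>1\<close> on; hence the shift in the sequence \<open>a\<close> of the proof.\<close>

lemma pg_sequence_increments_vanish:
  fixes f :: "real ^ 'n \<Rightarrow> real"
  assumes grad: "\<And>x. GDERIV f x :> gradient f x" and lip: "L-lipschitz_on UNIV (gradient f)"
    and bdd: "bdd_below (f ` sparse_set s)" and lam: "lam > 0" "L < inverse lam"
    and step: "\<And>k. w (Suc k) \<in> pg_step f s lam (w k)"
  shows "(\<lambda>k. w (Suc k) - w k) \<longlonglongrightarrow> 0"
proof -
  define c where "c = (inverse lam - L) / 2"
  define a where "a k = f (w (Suc k))" for k
  have c: "c > 0"
    using lam by (simp add: c_def)
  have A: "w (Suc k) \<in> sparse_set s" for k
    using step[of k] by (simp add: pg_step_def proj_set_def)
  have dec: "c * (norm (w (Suc (Suc k)) - w (Suc k)))\<^sup>2 \<le> a k - a (Suc k)" for k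
    unfolding c_def a_def by (rule pg_step_sufficient_decrease[OF grad lip lam(1) A step])
  have "0 \<le> c * (norm (w (Suc (Suc k)) - w (Suc k)))\<^sup>2" for k
    using c by simp
  with dec have "a (Suc k) \<le> a k" for k
    by (smt (verit))
  then have "decseq a"
    by (rule decseq_SucI)
  moreover obtain B where "\<And>k. B \<le> a k"
    using bdd A unfolding bdd_below_def a_def by blast
  ultimately obtain l where l: "a \<longlonglongrightarrow> l"
    using decseq_convergent by metis
  have bound: "(norm (w (Suc (Suc k)) - w (Suc k)))\<^sup>2 \<le> (a k - a (Suc k)) / c" for k
    using dec c by (simp add: pos_le_divide_eq mult.commute)
  have "(\<lambda>k. (a k - a (Suc k)) / c) \<longlonglongrightarrow> (l - l) / c"
    by (intro tendsto_intros l LIMSEQ_Suc[OF l]) (use c in auto)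
  then have upper: "(\<lambda>k. (a k - a (Suc k)) / c) \<longlonglongrightarrow> 0"
    by simp
  have "(\<lambda>k. (norm (w (Suc (Suc k)) - w (Suc k)))\<^sup>2) \<longlonglongrightarrow> 0"
    by (rule tendsto_sandwich[OF _ _ tendsto_const upper]) (use bound in auto)
  then have "(\<lambda>k. sqrt ((norm (w (Suc (Suc k)) - w (Suc k)))\<^sup>2)) \<longlonglongrightarrow> sqrt 0"
    by (rule tendsto_real_sqrt)
  then have "(\<lambda>k. w (Suc (Suc k)) - w (Suc k)) \<longlonglongrightarrow> 0"
    by (simp add: tendsto_norm_zero_iff)
  then show ?thesis
    by (rule LIMSEQ_imp_Suc)
qed

lemma pg_accumulation_point_fixed:
  fixes f :: "real ^ 'n \<Rightarrow> real"
  assumes cont: "continuous_on UNIV (gradient f)" and s: "s \<le> CARD('n)"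
    and step: "\<And>k. w (Suc k) \<in> pg_step f s lam (w k)"
    and incr: "(\<lambda>k. w (Suc k) - w k) \<longlonglongrightarrow> 0" and acc: "accumulation_point w x"
  shows "x \<in> pg_step f s lam x"
proof -
  obtain r where r: "strict_mono r" and wr: "(\<lambda>n. w (r n)) \<longlonglongrightarrow> x"
    using acc by (auto simp: accumulation_point_def o_def)
  have "(\<lambda>n. w (Suc (r n)) - w (r n)) \<longlonglongrightarrow> 0"
    using LIMSEQ_subseq_LIMSEQ[OF incr r] by (simp add: o_def)
  from tendsto_add[OF this wr] have next_lim: "(\<lambda>n. w (Suc (r n))) \<longlonglongrightarrow> x"
    by simp
  have "(\<lambda>n. gradient f (w (r n))) \<longlonglongrightarrow> gradient f x"
    using continuous_on_tendsto_compose[OF cont wr] by simp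
  with wr have "(\<lambda>n. w (r n) - lam *\<^sub>R gradient f (w (r n))) \<longlonglongrightarrow> x - lam *\<^sub>R gradient f x"
    by (intro tendsto_intros)
  from proj_set_closed_graph[OF closed_sparse_set[OF s] _ this next_lim] show ?thesis
    using step by (simp add: pg_step_def)
qed

text \<open>Once the sequence comes closer to \<open>x\<close> than \<open>min d e\<close>, the hypothesis keeps it there.\<close>

lemma locally_fejer_accumulation_point_limit:
  fixes w :: "nat \<Rightarrow> 'a::metric_space"
  assumes d: "d > 0" and fejer: "\<And>k. dist (w k) x < d \<Longrightarrow> dist (w (Suc k)) x \<le> dist (w k) x"
    and acc: "accumulation_point w x"
  shows "w \<longlonglongrightarrow> x"
proof (rule metric_LIMSEQ_I)
  fix e :: real assume e: "e > 0"
  obtain r where "(\<lambda>n. w (r n)) \<longlonglongrightarrow> x"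
    using acc by (auto simp: accumulation_point_def o_def)
  from metric_LIMSEQ_D[OF this, of "min d e"] obtain n where n: "dist (w (r n)) x < min d e"
    using d e by auto
  have "dist (w k) x < min d e" if "k \<ge> r n" for k
    using that
  proof (induction k rule: dec_induct)
    case base
    show ?case by (rule n)
  next
    case (step k)
    then show ?case using fejer[of k] by simp
  qed
  then show "\<exists>k0. \<forall>k\<ge>k0. dist (w k) x < e"
    by auto
qed

lemma sparse_sequence_identifies_subspaces:
  fixes w :: "nat \<Rightarrow> real ^ 'n"
  assumes s: "s \<le> CARD('n)" and A: "\<And>k. w (Suc k) \<in> sparse_set s" and lim: "w \<longlonglongrightarrow> x"
  shows "\<exists>N. w ` {N..} \<subseteq> (\<Union>J\<in>active_index_sets s x. coord_subspace J)"
proof -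
  have "\<forall>\<^sub>F k in sequentially. w k \<in> sparse_set s \<longrightarrow>
      (\<exists>J\<in>active_index_sets s x. w k \<in> coord_subspace J)"
    by (rule eventually_compose_filterlim[OF eventually_sparse_imp_active[OF s] lim])
  then obtain N where N: "\<And>k. k \<ge> N \<Longrightarrow> w k \<in> sparse_set s \<Longrightarrow>
      \<exists>J\<in>active_index_sets s x. w k \<in> coord_subspace J"
    by (auto simp: eventually_sequentially)
  have "w k \<in> (\<Union>J\<in>active_index_sets s x. coord_subspace J)" if "k \<ge> Suc N" for k
    using N[of k] A[of "k - 1"] that by auto
  then show ?thesis
    by (intro exI[of _ "Suc N"]) auto
qed

text \<open>The maximum of finitely many contraction constants is below \<open>1\<close>; the extra \<open>0\<close> covers empty
  \<open>I\<close>.\<close>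

lemma contraction_over_common_constant:
  assumes "finite I" "\<forall>i\<in>I. contraction_over (A i) F"
  obtains c where "0 \<le> c" "c < 1" "\<And>i. i \<in> I \<Longrightarrow> c-lipschitz_on (A i) F"
proof -
  obtain \<gamma> where \<gamma>: "\<And>i. i \<in> I \<Longrightarrow> \<gamma> i < 1" "\<And>i. i \<in> I \<Longrightarrow> (\<gamma> i)-lipschitz_on (A i) F"
    using assms(2) unfolding contraction_over_def by metis
  define c where "c = Max (insert 0 (\<gamma> ` I))"
  show thesis
  proof
    show "0 \<le> c" "c < 1"
      unfolding c_def using assms(1) \<gamma>(1) by auto
    show "c-lipschitz_on (A i) F" if "i \<in> I" for i
      using \<gamma>(2)[OF that] by (rule lipschitz_on_le) (use assms(1) that in \<open>simp add: c_def\<close>)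
  qed
qed

theorem theorem2p1:
  fixes f :: "real ^ 'n \<Rightarrow> real"
    and L lam :: real
    and s :: nat
    and w :: "nat \<Rightarrow> real ^ 'n"
  assumes "convex_on UNIV f"
    and "\<forall>x. f differentiable (at x)"
    and "L > 0"
    and "L-lipschitz_on UNIV (gradient f)"
    and "s \<le> CARD('n)"
    and "bdd_below (f ` sparse_set s)"
    and "0 < lam" and "lam < inverse L"
    and "\<forall>k. w (Suc k) \<in> pg_step f s lam (w k)"
  shows
    "(w 0 \<in> sparse_set s \<and> (\<forall>k. w (Suc k) = w k \<longrightarrow> w (Suc (Suc k)) = w (Suc k)) \<longrightarrow>
        (\<forall>k. f (w (Suc k)) < f (w k)) \<or> (\<exists>N>0. \<forall>k\<ge>N. w k = w N))
     \<and> (\<forall>x. accumulation_point w x \<longrightarrow>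
        x \<in> proj_set (sparse_set s) (x - lam *\<^sub>R gradient f x) \<and>
        stationary_point f (sparse_set s) x)
     \<and> (\<forall>x. w \<longlonglongrightarrow> x \<longrightarrow>
        (\<exists>N. w ` {N..} \<subseteq> (\<Union>J\<in>active_index_sets s x. coord_subspace J)))
     \<and> (\<forall>x. accumulation_point w x \<and> is_singleton (pg_step f s lam x) \<longrightarrow>
        local_minimum f (sparse_set s) x \<and> w \<longlonglongrightarrow> x \<and>
        (\<exists>N. w ` {N..} \<subseteq> (\<Union>J\<in>active_index_sets s x. coord_subspace J)))
     \<and> (\<forall>x. accumulation_point w x \<and> is_singleton (pg_step f s lam x) \<and>
        (\<forall>J \<in> active_index_sets s x.
           contraction_over (coord_subspace J) (\<lambda>y. y - lam *\<^sub>R gradient f y)) \<longrightarrow>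
        w \<longlonglongrightarrow> x \<and>
        (\<exists>N2 \<gamma>. 0 \<le> \<gamma> \<and> \<gamma> < 1 \<and>
           (\<forall>k\<ge>N2. norm (w (Suc k) - x) \<le> \<gamma> * norm (w k - x))))"
proof -
  note conv = assms(1) and lip = assms(4) and s = assms(5)
  note lam = \<open>0 < lam\<close>
  have grad: "GDERIV f x :> gradient f x" for x
    using assms(2) by (simp add: GDERIV_gradient)
  have L: "L < inverse lam" and lamL: "lam * L \<le> 2"
    using \<open>lam < inverse L\<close> \<open>L > 0\<close> lam by (auto simp: field_simps)
  have cont: "continuous_on UNIV (gradient f)"
    using lip by (rule lipschitz_on_continuous_on)
  have step: "w (Suc k) \<in> pg_step f s lam (w k)" for k
    using assms(9) by simp
  have A: "w (Suc k) \<in> sparse_set s" for k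
    using step[of k] by (simp add: pg_step_def proj_set_def)
  have incr: "(\<lambda>k. w (Suc k) - w k) \<longlonglongrightarrow> 0"
    by (rule pg_sequence_increments_vanish[where w = w, OF grad lip assms(6) lam L step])

  have fixed: "x \<in> pg_step f s lam x" if "accumulation_point w x" for x
    by (rule pg_accumulation_point_fixed[where w = w, OF cont s step incr that])
  have ident: "\<exists>N. w ` {N..} \<subseteq> (\<Union>J\<in>active_index_sets s x. coord_subspace J)"
    if "w \<longlonglongrightarrow> x" for x
    by (rule sparse_sequence_identifies_subspaces[where w = w, OF s A that])
  have contr: "\<exists>d>0. \<forall>k. dist (w k) x < d \<longrightarrow> norm (w (Suc k) - x)
      \<le> norm ((w k - lam *\<^sub>R gradient f (w k)) - (x - lam *\<^sub>R gradient f x))"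
    if "accumulation_point w x" "is_singleton (pg_step f s lam x)" for x
  proof -
    have "pg_step f s lam x = {x}"
      using fixed[OF that(1)] that(2) by (auto simp: is_singleton_def)
    from pg_step_near_singleton_fixed_point[OF cont s this] show ?thesis
      using step by metis
  qed
  have conv_full: "w \<longlonglongrightarrow> x"
    if acc: "accumulation_point w x" and single: "is_singleton (pg_step f s lam x)" for x
  proof -
    obtain d where "d > 0" and d: "\<And>k. dist (w k) x < d \<Longrightarrow> norm (w (Suc k) - x)
      \<le> norm ((w k - lam *\<^sub>R gradient f (w k)) - (x - lam *\<^sub>R gradient f x))"
      using contr[OF acc single] by blast
    have "dist (w (Suc k)) x \<le> dist (w k) x" if "dist (w k) x < d" for k
      using d[OF that]
        gradient_step_nonexpansive[OF conv grad lip \<open>L > 0\<close> less_imp_le[OF lam] lamL, of "w k" x]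
      by (simp add: dist_norm)
    with \<open>d > 0\<close> show ?thesis
      using acc by (rule locally_fejer_accumulation_point_limit)
  qed

  have descent: "(\<forall>k. f (w (Suc k)) < f (w k)) \<or> (\<exists>N>0. \<forall>k\<ge>N. w k = w N)"
    if w0: "w 0 \<in> sparse_set s" and stay: "\<forall>k. w (Suc k) = w k \<longrightarrow> w (Suc (Suc k)) = w (Suc k)"
  proof (rule disj_imp[THEN iffD2], rule impI)
    assume "\<not> (\<forall>k. f (w (Suc k)) < f (w k))"
    then obtain k where k: "f (w k) \<le> f (w (Suc k))"
      by (auto simp: not_less)
    have "w k \<in> sparse_set s"
      using w0 A by (cases k) auto
    from pg_step_sufficient_decrease[OF grad lip lam this step] k
    have "(inverse lam - L) / 2 * (norm (w (Suc k) - w k))\<^sup>2 \<le> 0"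
      by simp
    then have eq: "w (Suc k) = w k"
      using L by (auto simp: mult_le_0_iff)
    have stays: "w (Suc j) = w j" if "j \<ge> k" for j
      using that by (induction j rule: dec_induct) (use eq stay in auto)
    have eventually_const: "w j = w (Suc k)" if "j \<ge> Suc k" for j
      using that
    proof (induction j rule: dec_induct)
      case (step j)
      then show ?case using stays[of j] by simp
    qed simp
    show "\<exists>N>0. \<forall>k\<ge>N. w k = w N"
      by (intro exI conjI allI impI, rule zero_less_Suc) (rule eventually_const)
  qed

  have linear: "\<exists>N2 \<gamma>. 0 \<le> \<gamma> \<and> \<gamma> < 1 \<and> (\<forall>k\<ge>N2. norm (w (Suc k) - x) \<le> \<gamma> * norm (w k - x))"
    if acc: "accumulation_point w x" and single: "is_singleton (pg_step f s lam x)"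
      and contraction: "\<forall>J \<in> active_index_sets s x.
        contraction_over (coord_subspace J) (\<lambda>y. y - lam *\<^sub>R gradient f y)" for x
  proof -
    obtain \<gamma> where \<gamma>: "0 \<le> \<gamma>" "\<gamma> < 1" "\<And>J. J \<in> active_index_sets s x \<Longrightarrow>
        \<gamma>-lipschitz_on (coord_subspace J) (\<lambda>y. y - lam *\<^sub>R gradient f y)"
      using contraction_over_common_constant[OF finite contraction] by blast
    obtain d where "d > 0" and d: "\<And>k. dist (w k) x < d \<Longrightarrow> norm (w (Suc k) - x)
      \<le> norm ((w k - lam *\<^sub>R gradient f (w k)) - (x - lam *\<^sub>R gradient f x))"
      using contr[OF acc single] by blast
    note lim = conv_full[OF acc single]
    obtain N where N: "\<And>k. k \<ge> N \<Longrightarrow> dist (w k) x < d"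
      using metric_LIMSEQ_D[OF lim \<open>d > 0\<close>] by blast
    obtain M where M: "w ` {M..} \<subseteq> (\<Union>J\<in>active_index_sets s x. coord_subspace J)"
      using ident[OF lim] by blast
    have "norm (w (Suc k) - x) \<le> \<gamma> * norm (w k - x)" if k: "k \<ge> max N M" for k
    proof -
      obtain J where J: "J \<in> active_index_sets s x" "w k \<in> coord_subspace J"
        using M k by auto
      then have "x \<in> coord_subspace J"
        by (simp add: active_index_sets_def)
      from lipschitz_onD[OF \<gamma>(3)[OF J(1)] J(2) this] d[OF N[of k]] k show ?thesis
        by (simp add: dist_norm)
    qed
    with \<gamma>(1,2) show ?thesis
      by blast
  qed

  have stationary: "x \<in> proj_set (sparse_set s) (x - lam *\<^sub>R gradient f x) \<and>
      stationary_point f (sparse_set s) x" if "accumulation_point w x" for x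
    using fixed[OF that] proj_set_fixed_point_stationary[OF _ lam] by (auto simp: pg_step_def)
  have minimum: "local_minimum f (sparse_set s) x" if "accumulation_point w x" for x
    using fixed_point_local_minimum[OF conv grad s lam] fixed[OF that] by (simp add: pg_step_def)
  show ?thesis
    using descent stationary minimum ident conv_full linear by (intro conjI allI impI) blast+
qed

end
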